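(* Let $\mathcal{Z}\subseteq\mathbb{R}^n$ be a closed convex set, let $F:\mathcal{Z}\to\mathbb{R}^n$ be a monotone and $L$-Lipschitz operator, and let $z^*\in\mathcal{Z}$ be a solution of the variational inequality, i.e. $\langle F(z^* ),z^*-z\rangle\le0$ for all $z\in\mathcal{Z}$. Let $z_0,w_0\in\mathcal{Z}$ be arbitrary starting points and let $\{z_k,w_k\}_{k\ge0}$ be the iterates of the optimistic gradient descent-ascent (OGDA) algorithm with any step size $\eta\in(0,\frac{1}{2L})$. Let $$D_0:=\sqrt{(4+6\eta^4L^4)\|z_0-z^*\|^2+(16\eta^2L^2+6\eta^4L^4)\|w_0-z_0\|^2}\;=\;O\big(\max\{\|z_0-z^*\|,\|w_0-z_0\|\}\big).$$ Then for any $T\ge1$ (and any $D>0$): \begin{itemize} \item $\mathrm{Gap}_{\mathcal{Z},F,D}(z_T)\le\dfrac{D D_0}{\eta\sqrt{T(1-4(\eta L)^2)}}$; \item $r^{nat}_{(F,\mathcal{Z})}(z_T)\le r^{tan}_{(F,\mathcal{Z})}(z_T)\le\dfrac{D_0}{\eta\sqrt{T(1-4(\eta L)^2)}}$; \item $\mathrm{Gap}_{\mathcal{Z},F,D}(w_{T+1})\le\dfrac{\sqrt2(2+\eta L)\,D D_0}{\eta\sqrt{T(1-4(\eta L)^2)}}$; \item $r^{nat}_{(F,\mathcal{Z})}(w_{T+1})\le r^{tan}_{(F,\mathcal{Z})}(w_{T+1})\le\dfrac{\sqrt2(2+\eta L)D_0}{\eta\sqrt{T(1-4(\eta L)^2)}}$.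 \end{itemize}
   Context: $\|\cdot\|$ is the Euclidean norm and $\langle\cdot,\cdot\rangle$ the Euclidean inner product; $\Pi_C$ denotes Euclidean projection onto a closed convex set $C$. $F$ is monotone if $\langle F(z)-F(z'),z-z'\rangle\ge0$ for all $z,z'\in\mathcal{Z}$, and $L$-Lipschitz if $\|F(z)-F(z')\|\le L\|z-z'\|$ for all $z,z'\in\mathcal{Z}$ ($L>0$). OGDA algorithm: $w_{k+1}=\Pi_{\mathcal{Z}}[z_k-\eta F(w_k)]$, $z_{k+1}=\Pi_{\mathcal{Z}}[z_k-\eta F(w_{k+1})]$ for $k\ge0$. Gap function: $\mathrm{Gap}_{\mathcal{Z},F,D}(z)=\max_{z'\in\mathcal{Z}\cap\mathcal{B}(z,D)}\langle F(z),z-z'\rangle$, where $D>0$ is a fixed parameter and $\mathcal{B}(z,D)$ is the closed ball of radius $D$ centered at $z$. Natural residual: $r^{nat}_{(F,\mathcal{Z})}(z)=\|z-\Pi_{\mathcal{Z}}(z-F(z))\|$. Tangent residual: let $N_{\mathcal{Z}}(z)=\{v\in\mathbb{R}^n:\langle v,z'-z\rangle\le0\ \forall z'\in\mathcal{Z}\}$ be the normal cone, $T_{\mathcal{Z}}(z)=\{z'\in\mathbb{R}^n:\langle z',a\rangle\le0\ \forall a\in N_{\mathcal{Z}}(z)\}$ the tangent cone, and $J_{\mathcal{Z}}(z)=\{z\}+T_{\mathcal{Z}}(z)$. Then $r^{tan}_{(F,\mathcal{Z})}(z)=\|\Pi_{J_{\mathcal{Z}}(z)}[z-F(z)]-z\|$.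 The $O(\cdot)$ hides an absolute constant. *)

theory Defs
  imports "HOL-Analysis.Analysis"
begin

(* Operators are total functions on the ambient space; every notion below only uses
   their values on the feasible set Z.  The Euclidean projection onto a closed convex
   set C is the library's closest_point C. *)

definition monotone_operator_on :: "'a::real_inner set \<Rightarrow> ('a \<Rightarrow> 'a) \<Rightarrow> bool" where
  "monotone_operator_on Z F \<longleftrightarrow> (\<forall>z\<in>Z. \<forall>z'\<in>Z. inner (F z - F z') (z - z') \<ge> 0)"

definition vi_solution :: "'a::real_inner set \<Rightarrow> ('a \<Rightarrow> 'a) \<Rightarrow> 'a \<Rightarrow> bool" where
  "vi_solution Z F zs \<longleftrightarrow> zs \<in> Z \<and> (\<forall>z\<in>Z. inner (F zs) (zs - z) \<le> 0)"

definition ogda_iterates ::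
  "'a::euclidean_space set \<Rightarrow> ('a \<Rightarrow> 'a) \<Rightarrow> real \<Rightarrow> (nat \<Rightarrow> 'a) \<Rightarrow> (nat \<Rightarrow> 'a) \<Rightarrow> bool" where
  "ogda_iterates Z F \<eta> z w \<longleftrightarrow>
     (\<forall>k. w (Suc k) = closest_point Z (z k - \<eta> *\<^sub>R F (w k)) \<and>
          z (Suc k) = closest_point Z (z k - \<eta> *\<^sub>R F (w (Suc k))))"

(* A supremum of reals; for closed Z, z in Z and D \<ge> 0 it is a maximum, see gap_is_max. *)
definition gap :: "'a::euclidean_space set \<Rightarrow> ('a \<Rightarrow> 'a) \<Rightarrow> real \<Rightarrow> 'a \<Rightarrow> real" where
  "gap Z F D z = (SUP z'\<in>Z \<inter> cball z D. inner (F z) (z - z'))"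

lemma gap_is_max:
  assumes "closed Z" "z \<in> Z" "D \<ge> 0"
  shows "\<exists>z'\<in>Z \<inter> cball z D. gap Z F D z = inner (F z) (z - z') \<and>
           (\<forall>y\<in>Z \<inter> cball z D. inner (F z) (z - y) \<le> inner (F z) (z - z'))"
proof -
  have "compact (Z \<inter> cball z D)"
    using assms(1) by (simp add: closed_Int_compact)
  moreover have "Z \<inter> cball z D \<noteq> {}"
    using assms by auto
  moreover have "continuous_on (Z \<inter> cball z D) (\<lambda>y. inner (F z) (z - y))"
    by (intro continuous_intros)
  ultimately obtain z' where z': "z' \<in> Z \<inter> cball z D"
    "\<forall>y\<in>Z \<inter> cball z D. inner (F z) (z - y) \<le> inner (F z) (z - z')"
    using continuous_attains_sup by metis
  have "gap Z F D z = inner (F z) (z - z')"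
    unfolding gap_def using z' by (intro cSup_eq_maximum) auto
  then show ?thesis using z' by blast
qed

definition nat_residual :: "'a::euclidean_space set \<Rightarrow> ('a \<Rightarrow> 'a) \<Rightarrow> 'a \<Rightarrow> real" where
  "nat_residual Z F z = norm (z - closest_point Z (z - F z))"

definition normal_cone :: "'a::real_inner set \<Rightarrow> 'a \<Rightarrow> 'a set" where
  "normal_cone Z z = {v. \<forall>z'\<in>Z. inner v (z' - z) \<le> 0}"

definition tangent_cone :: "'a::real_inner set \<Rightarrow> 'a \<Rightarrow> 'a set" where
  "tangent_cone Z z = {z'. \<forall>a\<in>normal_cone Z z. inner z' a \<le> 0}"

definition tangent_translate :: "'a::real_inner set \<Rightarrow> 'a \<Rightarrow> 'a set" where
  "tangent_translate Z z = (\<lambda>t. z + t) ` tangent_cone Z z"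

definition tan_residual :: "'a::euclidean_space set \<Rightarrow> ('a \<Rightarrow> 'a) \<Rightarrow> 'a \<Rightarrow> real" where
  "tan_residual Z F z = norm (closest_point (tangent_translate Z z) (z - F z) - z)"

(* The constant D\<^sub>0, with a standing for the distance of z\<^sub>0 to the solution and
   b for the distance of w\<^sub>0 to z\<^sub>0. *)
definition ogda_D0 :: "real \<Rightarrow> real \<Rightarrow> real \<Rightarrow> real \<Rightarrow> real" where
  "ogda_D0 \<eta> L a b =
     sqrt ((4 + 6 * \<eta>^4 * L^4) * a\<^sup>2 + (16 * \<eta>\<^sup>2 * L\<^sup>2 + 6 * \<eta>^4 * L^4) * b\<^sup>2)"

end

theory Submission
  imports Defs
begin

text \<open>
  Write \<open>G = \<eta> F\<close> and \<open>l = \<eta> L < 1/2\<close>, so that the step size becomes one.  By the variational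
  characterisation of projections, one iteration from \<open>(z, w)\<close> to \<open>(z', w')\<close> reads
  \<open>w' = z - G w - d'\<close> and \<open>z' = z - G w' - c'\<close> with \<open>d'\<close> normal to \<open>Z\<close> at \<open>w'\<close> and \<open>c'\<close> normal
  to \<open>Z\<close> at \<open>z'\<close>.  The rate comes from combining two facts.

  The potential \<open>\<parallel>G z + c\<parallel>\<^sup>2 + \<parallel>G z - G w\<parallel>\<^sup>2\<close>, where \<open>c\<close> is the normal vector
  at \<open>z\<close> that the algorithm produced, never increases (\<open>ogda_potential_step\<close>).  On the other hand
  the energy \<open>\<parallel>z - z\<^sup>*\<parallel>\<^sup>2 + 4 l\<^sup>2 \<parallel>z - w\<parallel>\<^sup>2\<close> drops by
  at least \<open>(1 - 4 l\<^sup>2) (\<parallel>z - w'\<parallel>\<^sup>2 + \<parallel>w' - z'\<parallel>\<^sup>2)\<close> in each step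
  (\<open>ogda_energy_step\<close>), so these squared displacements are summable, and they dominate the
  potential (\<open>ogda_potential_bound\<close>).  Hence the sum of the potentials with indices \<open>1, \<dots>, T\<close> is at most
  \<open>D\<^sub>0\<^sup>2 / (1 - 4 l\<^sup>2)\<close>, and by monotonicity the last one is at most \<open>1/T\<close> times this
  (\<open>ogda_potential_rate\<close>).

  The tangent residual at \<open>z\<close> is the minimum of \<open>\<parallel>F z + c\<parallel>\<close> over all \<open>c\<close> normal to \<open>Z\<close>
  at \<open>z\<close> (\<open>tan_residual_attained\<close>, \<open>tan_residual_le\<close>), and for every such \<open>c\<close> the
  quantity \<open>\<parallel>F z + c\<parallel>\<close> bounds the natural residual and, up to the factor \<open>D\<close>, the gap.
  So the potential controls all three measures at \<open>z\<^sub>T\<close>.  For \<open>w\<^sub>T\<^sub>+\<^sub>1\<close> the normal vector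
  \<open>d'\<close> is used, and \<open>\<parallel>G w' + d'\<parallel>\<close> is compared with the potential at step \<open>T\<close>
  (\<open>ogda_lookahead_residual\<close>).
\<close>

section \<open>Normal cones, projections and residuals\<close>

lemma normal_coneD: "c \<in> normal_cone Z x \<Longrightarrow> y \<in> Z \<Longrightarrow> inner c (y - x) \<le> 0"
  by (simp add: normal_cone_def)

lemma zero_in_normal_cone: "0 \<in> normal_cone Z x"
  by (simp add: normal_cone_def)

lemma normal_cone_scaleR: "c \<in> normal_cone Z x \<Longrightarrow> t \<ge> 0 \<Longrightarrow> t *\<^sub>R c \<in> normal_cone Z x"
  by (simp add: normal_cone_def mult_nonneg_nonpos)

lemma closest_point_normal:
  fixes Z :: "'a::euclidean_space set"
  assumes "closed Z" "convex Z"
  shows "x - closest_point Z x \<in> normal_cone Z (closest_point Z x)"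
  using closest_point_dot[OF assms(2,1)] by (auto simp: normal_cone_def)

text \<open>Nonexpansiveness of the projection, with \<open>x\<close> and \<open>y\<close> the projections of
  \<open>x + c\<close> and \<open>y + d\<close>.\<close>

lemma normal_cone_nonexpansive:
  assumes "x \<in> Z" "y \<in> Z" "c \<in> normal_cone Z x" "d \<in> normal_cone Z y"
  shows "norm (x - y) \<le> norm ((x + c) - (y + d))"
proof -
  have "inner c (y - x) \<le> 0" "inner d (x - y) \<le> 0"
    using assms by (auto intro: normal_coneD)
  then have "inner (x - y) (x - y) \<le> inner ((x + c) - (y + d)) (x - y)"
    by (simp add: inner_simps)
  also have "\<dots> \<le> norm ((x + c) - (y + d)) * norm (x - y)"
    by (rule norm_cauchy_schwarz)
  finally have "norm (x - y) * norm (x - y) \<le> norm ((x + c) - (y + d)) * norm (x - y)"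
    by (simp add: power2_norm_eq_inner flip: power2_eq_square)
  then show ?thesis
    by (cases "x = y") auto
qed

lemma tangent_cone_convex_cone:
  shows "closed (tangent_cone Z x)" "convex (tangent_cone Z x)" "0 \<in> tangent_cone Z x"
    and "s \<in> tangent_cone Z x \<Longrightarrow> t \<in> tangent_cone Z x \<Longrightarrow> s + t \<in> tangent_cone Z x"
proof -
  have eq: "tangent_cone Z x = (\<Inter>a\<in>normal_cone Z x. {t. inner a t \<le> 0})"
    by (auto simp: tangent_cone_def inner_commute)
  show "closed (tangent_cone Z x)" "convex (tangent_cone Z x)"
    unfolding eq by (auto intro!: closed_halfspace_le convex_INT convex_halfspace_le)
  show "0 \<in> tangent_cone Z x"
    by (simp add: tangent_cone_def)
  show "s \<in> tangent_cone Z x \<Longrightarrow> t \<in> tangent_cone Z x \<Longrightarrow> s + t \<in> tangent_cone Z x"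
    by (fastforce simp: tangent_cone_def inner_simps)
qed

lemma diff_in_tangent_cone: "y \<in> Z \<Longrightarrow> y - x \<in> tangent_cone Z x"
  by (auto simp: tangent_cone_def normal_cone_def inner_commute)

lemma tangent_projection:
  fixes Z :: "'a::euclidean_space set" and x y :: 'a
  defines "p \<equiv> closest_point (tangent_translate Z x) y"
  shows "p - x \<in> tangent_cone Z x"
    and "s \<in> tangent_cone Z x \<Longrightarrow> inner (y - p) (s - (p - x)) \<le> 0"
proof -
  have cl: "closed (tangent_translate Z x)" and cv: "convex (tangent_translate Z x)"
    unfolding tangent_translate_def
    using closed_translation[OF tangent_cone_convex_cone(1)]
      convex_translation[OF tangent_cone_convex_cone(2)] by auto
  have ne: "tangent_translate Z x \<noteq> {}"
    using tangent_cone_convex_cone(3) by (auto simp: tangent_translate_def)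
  have "p \<in> tangent_translate Z x"
    unfolding p_def by (rule closest_point_in_set[OF cl ne])
  then show "p - x \<in> tangent_cone Z x"
    by (auto simp: tangent_translate_def)
  assume "s \<in> tangent_cone Z x"
  then have "x + s \<in> tangent_translate Z x"
    by (auto simp: tangent_translate_def)
  from closest_point_dot[OF cv cl this, of y]
  show "inner (y - p) (s - (p - x)) \<le> 0"
    unfolding p_def by (simp add: algebra_simps)
qed

text \<open>The next two lemmas are Moreau's decomposition of \<open>- F x\<close> into its tangential and its
  normal part: the tangent residual is the distance of \<open>- F x\<close> to the normal cone.\<close>

lemma tan_residual_attained:
  fixes Z :: "'a::euclidean_space set"
  shows "\<exists>c\<in>normal_cone Z x. tan_residual Z F x = norm (F x + c)"
proof -
  define p where "p = closest_point (tangent_translate Z x) (x - F x)"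
  let ?c = "(x - F x) - p"
  note tp = tangent_projection[where Z = Z and x = x and y = "x - F x", folded p_def]
  have "inner ?c (y - x) \<le> 0" if "y \<in> Z" for y
    \<comment> \<open>compare the projection with its shift by the tangent direction \<open>y - x\<close>\<close>
    using tp(2)[OF tangent_cone_convex_cone(4)[OF tp(1) diff_in_tangent_cone[OF that, of x]]] by simp
  then have "?c \<in> normal_cone Z x"
    by (simp add: normal_cone_def)
  moreover have "tan_residual Z F x = norm (F x + ?c)"
    unfolding tan_residual_def p_def[symmetric] by (simp add: norm_minus_commute)
  ultimately show ?thesis by blast
qed

lemma tan_residual_le:
  fixes Z :: "'a::euclidean_space set"
  assumes c: "c \<in> normal_cone Z x"
  shows "tan_residual Z F x \<le> norm (F x + c)"
proof -
  define t where "t = closest_point (tangent_translate Z x) (x - F x) - x"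
  note tp = tangent_projection[where Z = Z and x = x and y = "x - F x", folded t_def]
  have "inner t c \<le> 0"
    using tp(1) c by (simp add: tangent_cone_def)
  moreover have "inner (- F x - t) (0 - t) \<le> 0"
    using tp(2)[OF tangent_cone_convex_cone(3)] by (simp add: t_def algebra_simps)
  ultimately have "inner t t \<le> inner (- (F x + c)) t"
    by (simp add: inner_simps inner_commute)
  also have "\<dots> \<le> norm (F x + c) * norm t"
    using norm_cauchy_schwarz[of "- (F x + c)" t] by (simp only: norm_minus_cancel)
  finally have "norm t * norm t \<le> norm (F x + c) * norm t"
    by (simp add: power2_norm_eq_inner flip: power2_eq_square)
  then have "norm t \<le> norm (F x + c)"
    by (cases "t = 0") auto
  then show ?thesis
    by (simp add: tan_residual_def t_def)
qed

lemma nat_residual_le_tan_residual: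
  fixes Z :: "'a::euclidean_space set"
  assumes "closed Z" "convex Z" "x \<in> Z"
  shows "nat_residual Z F x \<le> tan_residual Z F x"
proof -
  obtain c where c: "c \<in> normal_cone Z x" "tan_residual Z F x = norm (F x + c)"
    using tan_residual_attained by blast
  let ?u = "closest_point Z (x - F x)"
  have "?u \<in> Z"
    using assms by (intro closest_point_in_set) auto
  from normal_cone_nonexpansive[OF assms(3) this c(1) closest_point_normal[OF assms(1,2)]]
  show ?thesis
    by (simp add: nat_residual_def c(2) algebra_simps)
qed

lemma gap_le_tan_residual:
  fixes Z :: "'a::euclidean_space set"
  assumes "closed Z" "x \<in> Z" "D \<ge> 0"
  shows "gap Z F D x \<le> D * tan_residual Z F x"
proof -
  obtain c where c: "c \<in> normal_cone Z x" "tan_residual Z F x = norm (F x + c)"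
    using tan_residual_attained by blast
  obtain y where y: "y \<in> Z" "y \<in> cball x D" "gap Z F D x = inner (F x) (x - y)"
    using gap_is_max[OF assms] by blast
  have "inner (F x) (x - y) \<le> inner (F x + c) (x - y)"
    using normal_coneD[OF c(1) y(1)] by (simp add: inner_simps)
  also have "\<dots> \<le> norm (F x + c) * norm (x - y)"
    by (rule norm_cauchy_schwarz)
  also have "\<dots> \<le> norm (F x + c) * D"
    using y(2) by (intro mult_left_mono) (auto simp: dist_norm)
  finally show ?thesis
    by (simp add: y(3) c(2) mult.commute)
qed

section \<open>One step of the algorithm\<close>

lemma norm_add_sq_le:
  fixes x y :: "'a::real_inner"
  shows "(norm (x + y))\<^sup>2 \<le> 2 * (norm x)\<^sup>2 + 2 * (norm y)\<^sup>2"
proof -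
  have "0 \<le> (norm (x - y))\<^sup>2" by simp
  then show ?thesis
    by (simp add: power2_norm_eq_inner inner_simps inner_commute)
qed

text \<open>The residual of \<open>z\<close> certified by the normal vector \<open>c\<close>, plus the error made by
  evaluating the operator at \<open>w\<close> instead of \<open>z\<close>.\<close>

definition ogda_potential :: "('a::real_inner \<Rightarrow> 'a) \<Rightarrow> 'a \<Rightarrow> 'a \<Rightarrow> 'a \<Rightarrow> real" where
  "ogda_potential G z w c = (norm (G z + c))\<^sup>2 + (norm (G z - G w))\<^sup>2"

text \<open>A single iteration with unit step size.  The vector \<open>c\<close> is any normal vector at \<open>z\<close>; the
  vectors \<open>d'\<close> and \<open>c'\<close> are the displacements caused by the two projections.\<close>

locale ogda_step =
  fixes Z :: "'a::real_inner set" and G :: "'a \<Rightarrow> 'a" and l :: real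
    and z w z' w' c c' d' :: 'a
  assumes mono: "monotone_operator_on Z G"
    and lip: "l-lipschitz_on Z G"
    and l_half: "l \<le> 1 / 2"
    and mem: "z \<in> Z" "w \<in> Z" "z' \<in> Z" "w' \<in> Z"
    and normal: "c \<in> normal_cone Z z" "c' \<in> normal_cone Z z'" "d' \<in> normal_cone Z w'"
    and w'_eq: "w' = z - G w - d'"
    and z'_eq: "z' = z - G w' - c'"
begin

lemma l_nonneg: "0 \<le> l"
  using lip by (rule lipschitz_on_nonneg)

lemma lip_sq:
  assumes "x \<in> Z" "y \<in> Z"
  shows "(norm (G x - G y))\<^sup>2 \<le> l\<^sup>2 * (norm (x - y))\<^sup>2"
proof -
  have "norm (G x - G y) \<le> l * norm (x - y)"
    using lipschitz_onD[OF lip assms] by (simp add: dist_norm)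
  then have "(norm (G x - G y))\<^sup>2 \<le> (l * norm (x - y))\<^sup>2"
    by (intro power_mono) auto
  then show ?thesis by (simp add: power_mult_distrib)
qed

lemma l_sq: "4 * l\<^sup>2 \<le> 1"
  using power_mono[OF l_half l_nonneg, of 2] by (simp add: power2_eq_square)

lemma ogda_potential_step:
  "ogda_potential G z' w' c' \<le> ogda_potential G z w c"
proof -
  let ?a = "G z" and ?b = "G w" and ?p = "G w'" and ?q = "G z'"
  have zz: "z - z' = ?p + c'" and zw: "z - w' = ?b + d'" and wz: "w' - z' = ?p + c' - ?b - d'"
    using w'_eq z'_eq by (auto simp: algebra_simps)
  have m: "inner (?a - ?q) (z - z') \<ge> 0"
    using mono mem by (auto simp: monotone_operator_on_def)
  have n: "inner c (z' - z) \<le> 0" "inner c (w' - z) \<le> 0" "inner c' (z - z') \<le> 0"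
    "inner d' (z' - w') \<le> 0"
    using normal mem by (auto intro: normal_coneD)
  have "2 * (norm (?q - ?p))\<^sup>2 \<le> 2 * (l\<^sup>2 * (norm (w' - z'))\<^sup>2)"
    using lip_sq[OF mem(3,4)] by (simp add: norm_minus_commute)
  also have "\<dots> \<le> (norm (w' - z'))\<^sup>2 / 2"
    using mult_right_mono[OF l_sq, of "(norm (w' - z'))\<^sup>2"] by simp
  finally have L: "2 * (norm (?q - ?p))\<^sup>2 \<le> (norm (w' - z'))\<^sup>2 / 2" .
  \<comment> \<open>Monotonicity, tested along \<open>z - z' = G w' + c'\<close>, completes the squares.\<close>
  have A: "ogda_potential G z w c - ogda_potential G z' w' c'
    = (norm (?a + c - ?p - c'))\<^sup>2 + (norm (?a - ?b))\<^sup>2 - 2 * (norm (?q - ?p))\<^sup>2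
      + 2 * inner (?a - ?q) (z - z') - 2 * inner c (z' - z) - 2 * inner c' (z - z')"
  proof -
    have "z' - z = - (?p + c')" using zz by (simp add: algebra_simps)
    then show ?thesis
      unfolding zz ogda_potential_def
      by (simp add: power2_norm_eq_inner inner_simps inner_commute)
  qed
  have B: "(norm (?b + c - ?p - c'))\<^sup>2
      \<le> 2 * ((norm (?a + c - ?p - c'))\<^sup>2 + (norm (?a - ?b))\<^sup>2)"
    using norm_add_sq_le[of "?a + c - ?p - c'" "- (?a - ?b)"]
    by (simp add: norm_minus_commute algebra_simps)
  \<comment> \<open>The term \<open>inner c (z - z')\<close>, which has the wrong sign here, is absorbed by the slack
    that the same term leaves in the identity for the potential difference.\<close>
  have C: "(norm (?b + c - ?p - c'))\<^sup>2
    = (norm (w' - z'))\<^sup>2 + (norm (c - d'))\<^sup>2 - 2 * inner d' (z' - w')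
      - 2 * inner c (w' - z) + 2 * inner c (z' - z)"
  proof -
    have eq: "?b + c - ?p - c' = (c - d') - (w' - z')" using wz by (simp add: algebra_simps)
    show ?thesis
      unfolding eq by (simp add: power2_norm_eq_inner inner_simps inner_commute)
  qed
  have "0 \<le> (norm (c - d'))\<^sup>2" by simp
  then show ?thesis
    using A B C L m n by argo
qed

lemma half_step_le: "norm (w' - z') \<le> norm (G w - G w')"
proof -
  have "(w' + d') - (z' + c') = G w' - G w"
    using w'_eq z'_eq by (simp add: algebra_simps)
  then show ?thesis
    using normal_cone_nonexpansive[OF mem(4,3) normal(3,2)] by (simp add: norm_minus_commute)
qed

lemma operator_diff_sq_le:
  "(norm (G w - G w'))\<^sup>2 \<le> 2 * l\<^sup>2 * ((norm (z - w))\<^sup>2 + (norm (z - w'))\<^sup>2)"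
proof -
  have "(norm (w - w'))\<^sup>2 \<le> 2 * (norm (z - w))\<^sup>2 + 2 * (norm (z - w'))\<^sup>2"
    using norm_add_sq_le[of "w - z" "z - w'"] by (simp add: norm_minus_commute)
  then have "l\<^sup>2 * (norm (w - w'))\<^sup>2 \<le> l\<^sup>2 * (2 * (norm (z - w))\<^sup>2 + 2 * (norm (z - w'))\<^sup>2)"
    by (intro mult_left_mono) auto
  then show ?thesis
    using lip_sq[OF mem(2,4)] by (simp add: algebra_simps)
qed

lemma ogda_energy_step:
  assumes zs: "vi_solution Z G zs"
  shows "(norm (z' - zs))\<^sup>2 + 4 * l\<^sup>2 * (norm (z' - w'))\<^sup>2
      + (1 - 4 * l\<^sup>2) * ((norm (z - w'))\<^sup>2 + (norm (z' - w'))\<^sup>2)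
    \<le> (norm (z - zs))\<^sup>2 + 4 * l\<^sup>2 * (norm (z - w))\<^sup>2"
proof -
  have zsZ: "zs \<in> Z" and "inner (G zs) (zs - w') \<le> 0"
    using zs mem by (auto simp: vi_solution_def)
  moreover have "inner (G w' - G zs) (w' - zs) \<ge> 0"
    using mono mem zsZ by (auto simp: monotone_operator_on_def)
  ultimately have p: "inner (G w') (w' - zs) \<ge> 0"
    by (simp add: inner_simps)
  have n: "inner c' (zs - z') \<le> 0" "inner d' (z' - w') \<le> 0"
    using normal mem zsZ by (auto intro: normal_coneD)
  have "inner (G w - G w') (z' - w') \<le> norm (G w - G w') * norm (z' - w')"
    by (rule norm_cauchy_schwarz)
  also have "\<dots> \<le> norm (G w - G w') * norm (G w - G w')"
    using half_step_le by (intro mult_left_mono) (auto simp: norm_minus_commute)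
  also have "\<dots> \<le> 2 * l\<^sup>2 * ((norm (z - w))\<^sup>2 + (norm (z - w'))\<^sup>2)"
    using operator_diff_sq_le by (simp add: power2_eq_square)
  finally have cross: "2 * inner (G w - G w') (z' - w')
      \<le> 4 * l\<^sup>2 * ((norm (z - w))\<^sup>2 + (norm (z - w'))\<^sup>2)"
    by simp
  have "(norm (z' - zs))\<^sup>2
    = (norm (z - zs))\<^sup>2 - (norm (z - w'))\<^sup>2 - (norm (z' - w'))\<^sup>2
      - 2 * inner (z - z') (z' - zs) + 2 * inner (z - w') (z' - w')"
    by (simp add: power2_norm_eq_inner inner_simps inner_commute)
  also have "inner (z - z') (z' - zs)
    = inner (G w') (w' - zs) + inner (G w') (z' - w') - inner c' (zs - z')"
  proof -
    have "z - z' = G w' + c'" using z'_eq by (simp add: algebra_simps)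
    then show ?thesis by (simp add: inner_simps)
  qed
  also have "inner (z - w') (z' - w') = inner (G w) (z' - w') + inner d' (z' - w')"
  proof -
    have "z - w' = G w + d'" using w'_eq by (simp add: algebra_simps)
    then show ?thesis by (simp add: inner_add_left)
  qed
  finally show ?thesis
    using p n cross by (simp add: inner_diff_left algebra_simps)
qed

lemma ogda_potential_bound:
  "ogda_potential G z' w' c'
    \<le> 4 * ((norm (z - w'))\<^sup>2 + (norm (z' - w'))\<^sup>2)
      + 6 * l^4 * ((norm (z - w))\<^sup>2 + (norm (z - w'))\<^sup>2)"
proof -
  have eq: "G z' + c' = (z - z') + (G z' - G w')"
    using z'_eq by (simp add: algebra_simps)
  have 1: "(norm (G z' + c'))\<^sup>2 \<le> 2 * (norm (z - z'))\<^sup>2 + 2 * (norm (G z' - G w'))\<^sup>2"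
    unfolding eq by (rule norm_add_sq_le)
  have 2: "(norm (z - z'))\<^sup>2 \<le> 2 * (norm (z - w'))\<^sup>2 + 2 * (norm (z' - w'))\<^sup>2"
    using norm_add_sq_le[of "z - w'" "w' - z'"] by (simp add: norm_minus_commute)
  have "(norm (z' - w'))\<^sup>2 \<le> (norm (G w - G w'))\<^sup>2"
    using half_step_le by (intro power_mono) (auto simp: norm_minus_commute)
  also note operator_diff_sq_le
  finally have "l\<^sup>2 * (norm (z' - w'))\<^sup>2
      \<le> l\<^sup>2 * (2 * l\<^sup>2 * ((norm (z - w))\<^sup>2 + (norm (z - w'))\<^sup>2))"
    by (intro mult_left_mono) auto
  also have "\<dots> = 2 * l^4 * ((norm (z - w))\<^sup>2 + (norm (z - w'))\<^sup>2)"
    by (simp add: power2_eq_square power4_eq_xxxx)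
  finally have 3: "(norm (G z' - G w'))\<^sup>2 \<le> 2 * l^4 * ((norm (z - w))\<^sup>2 + (norm (z - w'))\<^sup>2)"
    using lip_sq[OF mem(3,4)] by linarith
  show ?thesis
    unfolding ogda_potential_def using 1 2 3 by argo
qed

lemma ogda_lookahead_residual:
  "norm (G w' + d') \<le> sqrt 2 * (2 + l) * sqrt (ogda_potential G z w c)"
proof -
  let ?P = "sqrt (ogda_potential G z w c)"
  have "norm (G z + c) + norm (G z - G w) \<le> sqrt 2 * ?P"
  proof -
    have "(norm (G z + c) + norm (G z - G w))\<^sup>2 \<le> 2 * ogda_potential G z w c"
      using sum_squares_bound[of "norm (G z + c)" "norm (G z - G w)"]
      by (simp add: ogda_potential_def power2_sum)
    then show ?thesis
      by (metis real_le_rsqrt real_sqrt_mult)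
  qed
  moreover have "norm (G w + c) \<le> norm (G z + c) + norm (G z - G w)"
    using norm_triangle_ineq4[of "G z + c" "G z - G w"] by (simp add: add.commute)
  ultimately have s: "norm (G w + c) \<le> sqrt 2 * ?P" "norm (G z - G w) \<le> sqrt 2 * ?P"
    by (auto intro: order_trans[rotated] simp: algebra_simps)
  have eq: "z + c - (w' + d') = G w + c"
    using w'_eq by (simp add: algebra_simps)
  have x: "norm (z - w') \<le> sqrt 2 * ?P"
    using normal_cone_nonexpansive[OF mem(1,4) normal(1,3)] s(1) unfolding eq by (rule order_trans)
  have "norm (G w' - G z) \<le> l * norm (z - w')"
    using lipschitz_onD[OF lip mem(4,1)] by (simp add: dist_norm norm_minus_commute)
  also have "\<dots> \<le> l * (sqrt 2 * ?P)"
    using x l_nonneg by (rule mult_left_mono)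
  finally have y: "norm (G w' - G z) \<le> l * (sqrt 2 * ?P)" .
  have "G w' + d' = (G w' - G z) + (G z - G w) + (z - w')"
    using w'_eq by (simp add: algebra_simps)
  then have "norm (G w' + d') \<le> norm (G w' - G z) + norm (G z - G w) + norm (z - w')"
    by (metis norm_triangle_ineq norm_triangle_le add_right_mono order_trans)
  then have "norm (G w' + d') \<le> l * (sqrt 2 * ?P) + sqrt 2 * ?P + sqrt 2 * ?P"
    using s(2) x y by linarith
  then show ?thesis
    by (simp add: algebra_simps)
qed

end

section \<open>Rate of the potential\<close>

text \<open>The normal vector at \<open>z k\<close> produced by the \<open>k\<close>-th projection; no projection has been made
  at the starting point, where the zero vector serves.\<close>

definition ogda_normal :: "('a::real_normed_vector \<Rightarrow> 'a) \<Rightarrow> (nat \<Rightarrow> 'a) \<Rightarrow> (nat \<Rightarrow> 'a) \<Rightarrow> nat \<Rightarrow> 'a" where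
  "ogda_normal G z w k = (case k of 0 \<Rightarrow> 0 | Suc j \<Rightarrow> z j - G (w k) - z k)"

lemma ogda_iterates_mem:
  assumes "ogda_iterates Z G \<eta> z w" "closed Z" "z 0 \<in> Z" "w 0 \<in> Z"
  shows "z k \<in> Z" "w k \<in> Z"
proof -
  have "Z \<noteq> {}" using assms(3) by auto
  then show "z k \<in> Z" "w k \<in> Z"
    using assms by (cases k; auto simp: ogda_iterates_def intro: closest_point_in_set)+
qed

lemma ogda_normal_in_normal_cone:
  assumes "ogda_iterates Z G 1 z w" "closed Z" "convex Z"
  shows "ogda_normal G z w k \<in> normal_cone Z (z k)"
proof (cases k)
  case (Suc j)
  then have "z k = closest_point Z (z j - G (w k))"
    using assms(1) by (simp add: ogda_iterates_def)
  then show ?thesis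
    using closest_point_normal[OF assms(2,3), of "z j - G (w k)"] by (simp add: ogda_normal_def Suc)
qed (simp add: ogda_normal_def zero_in_normal_cone)

lemma ogda_iterates_step:
  fixes Z :: "'a::euclidean_space set"
  assumes it: "ogda_iterates Z G 1 z w" and Z: "closed Z" "convex Z" and 0: "z 0 \<in> Z" "w 0 \<in> Z"
    and G: "monotone_operator_on Z G" "l-lipschitz_on Z G" "l \<le> 1 / 2"
  shows "ogda_step Z G l (z k) (w k) (z (Suc k)) (w (Suc k))
    (ogda_normal G z w k) (ogda_normal G z w (Suc k)) (z k - G (w k) - w (Suc k))"
proof
  have "w (Suc k) = closest_point Z (z k - G (w k))"
    using it by (simp add: ogda_iterates_def)
  then show "z k - G (w k) - w (Suc k) \<in> normal_cone Z (w (Suc k))"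
    using closest_point_normal[OF Z, of "z k - G (w k)"] by simp
  show "z (Suc k) = z k - G (w (Suc k)) - ogda_normal G z w (Suc k)"
    by (simp add: ogda_normal_def)
qed (use G ogda_iterates_mem[OF it Z(1) 0] ogda_normal_in_normal_cone[OF it Z] in auto)

lemma ogda_potential_rate:
  fixes Z :: "'a::euclidean_space set"
  assumes step: "\<And>k. ogda_step Z G l (z k) (w k) (z (Suc k)) (w (Suc k)) (c k) (c (Suc k)) (d k)"
    and l: "l < 1 / 2" and zs: "vi_solution Z G zs"
  shows "real T * (1 - 4 * l\<^sup>2) * ogda_potential G (z T) (w T) (c T)
    \<le> (4 + 6 * l^4) * (norm (z 0 - zs))\<^sup>2 + (16 * l\<^sup>2 + 6 * l^4) * (norm (w 0 - z 0))\<^sup>2"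
proof -
  define \<Phi> where "\<Phi> k = ogda_potential G (z k) (w k) (c k)" for k
  define e where "e k = (norm (z k - w k))\<^sup>2" for k
  define x where "x k = (norm (z k - w (Suc k)))\<^sup>2" for k
  define V where "V k = (norm (z k - zs))\<^sup>2 + 4 * l\<^sup>2 * e k" for k
  define \<delta> where "\<delta> = 1 - 4 * l\<^sup>2"
  have e0: "e k \<ge> 0" and V0: "V k \<ge> 0" for k
    by (simp_all add: e_def V_def)
  have "l \<ge> 0"
    using ogda_step.l_nonneg[OF step] .
  then have "l\<^sup>2 < (1 / 2)\<^sup>2"
    using l by (intro power_strict_mono) auto
  then have \<delta>: "\<delta> > 0"
    by (simp add: \<delta>_def power2_eq_square)
  have mono: "\<Phi> (Suc k) \<le> \<Phi> k" for k
    unfolding \<Phi>_def by (rule ogda_step.ogda_potential_step[OF step])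
  have energy: "V (Suc k) + \<delta> * (x k + e (Suc k)) \<le> V k" for k
    using ogda_step.ogda_energy_step[OF step zs, of k] by (simp add: V_def e_def x_def \<delta>_def)
  have bound: "\<Phi> (Suc k) \<le> 4 * (x k + e (Suc k)) + 6 * l^4 * (e k + x k)" for k
    using ogda_step.ogda_potential_bound[OF step, of k] by (simp add: \<Phi>_def e_def x_def)
  have sum1: "\<delta> * (\<Sum>k<n. x k + e (Suc k)) \<le> V 0" for n
  proof -
    have "V n + \<delta> * (\<Sum>k<n. x k + e (Suc k)) \<le> V 0"
    proof (induction n)
      case (Suc n)
      then show ?case using energy[of n] by (simp add: distrib_left)
    qed simp
    then show ?thesis using V0[of n] by linarith
  qed
  \<comment> \<open>Shifting the index of \<open>e\<close> costs only the term \<open>e 0\<close>.\<close>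
  have shift: "(\<Sum>k<n. e k + x k) \<le> e 0 + (\<Sum>k<n. x k + e (Suc k))" for n
  proof -
    have "(\<Sum>k<n. e k + x k) + e n = e 0 + (\<Sum>k<n. x k + e (Suc k))"
      by (induction n) auto
    then show ?thesis using e0[of n] by linarith
  qed
  have sum2: "\<delta> * (\<Sum>k<n. e k + x k) \<le> (norm (z 0 - zs))\<^sup>2 + e 0" for n
  proof -
    have "\<delta> * (\<Sum>k<n. e k + x k) \<le> \<delta> * (e 0 + (\<Sum>k<n. x k + e (Suc k)))"
      using shift \<delta> by (intro mult_left_mono) auto
    also have "\<dots> \<le> \<delta> * e 0 + V 0"
      using sum1[of n] by (simp add: distrib_left)
    also have "\<dots> = (norm (z 0 - zs))\<^sup>2 + e 0"
      by (simp add: V_def \<delta>_def algebra_simps)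
    finally show ?thesis .
  qed
  have "\<Phi> T \<le> \<Phi> (Suc k)" if "k < T" for k
    using lift_Suc_antimono_le[of \<Phi>, OF mono] that by simp
  then have "(\<Sum>k<T. \<Phi> T) \<le> (\<Sum>k<T. 4 * (x k + e (Suc k)) + 6 * l^4 * (e k + x k))"
    using bound by (intro sum_mono) (meson lessThan_iff order_trans)
  also have "\<dots> = 4 * (\<Sum>k<T. x k + e (Suc k)) + 6 * l^4 * (\<Sum>k<T. e k + x k)"
    by (simp only: sum.distrib[of "\<lambda>k. 4 * (x k + e (Suc k))"] sum_distrib_left)
  finally have "\<delta> * (real T * \<Phi> T)
    \<le> \<delta> * (4 * (\<Sum>k<T. x k + e (Suc k)) + 6 * l^4 * (\<Sum>k<T. e k + x k))"
    using \<delta> by (intro mult_left_mono) auto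
  also have "\<dots> = 4 * (\<delta> * (\<Sum>k<T. x k + e (Suc k))) + 6 * l^4 * (\<delta> * (\<Sum>k<T. e k + x k))"
    by (simp only: distrib_left mult.left_commute)
  also have "\<dots> \<le> 4 * V 0 + 6 * l^4 * ((norm (z 0 - zs))\<^sup>2 + e 0)"
    using sum1[of T] mult_left_mono[OF sum2[of T], of "6 * l^4"] by simp
  also have "\<dots> = (4 + 6 * l^4) * (norm (z 0 - zs))\<^sup>2 + (16 * l\<^sup>2 + 6 * l^4) * (norm (w 0 - z 0))\<^sup>2"
    by (simp add: V_def e_def norm_minus_commute algebra_simps)
  finally show ?thesis
    by (simp add: \<Phi>_def \<delta>_def mult.assoc mult.left_commute mult.commute)
qed

section \<open>Last-iterate bounds\<close>

text \<open>Since \<open>\<eta> L < 1/2\<close>, the two coefficients in \<open>D\<^sub>0\<^sup>2\<close> add up to less than \<open>9\<close>.\<close>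

lemma ogda_D0_le_max:
  assumes "L > 0" "0 < \<eta>" "\<eta> < 1 / (2 * L)" "a \<ge> 0" "b \<ge> 0"
  shows "ogda_D0 \<eta> L a b \<le> 3 * max a b"
proof -
  let ?m = "max a b"
  have l: "0 \<le> \<eta> * L" "\<eta> * L \<le> 1 / 2"
    using assms by (auto simp: field_simps)
  have 2: "\<eta>\<^sup>2 * L\<^sup>2 \<le> 1 / 4"
    using power_mono[OF l(2,1), of 2] by (simp add: power_mult_distrib power_divide)
  have 4: "\<eta>^4 * L^4 \<le> 1 / 16"
    using power_mono[OF l(2,1), of 4] by (simp add: power_mult_distrib power_divide)
  have m: "a\<^sup>2 \<le> ?m\<^sup>2" "b\<^sup>2 \<le> ?m\<^sup>2"
    using assms by (auto intro!: power_mono)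
  have "(4 + 6 * \<eta>^4 * L^4) * a\<^sup>2 \<le> (9 / 2) * ?m\<^sup>2"
    using 4 m by (intro mult_mono) auto
  moreover have "(16 * \<eta>\<^sup>2 * L\<^sup>2 + 6 * \<eta>^4 * L^4) * b\<^sup>2 \<le> (9 / 2) * ?m\<^sup>2"
    using 2 4 m by (intro mult_mono) auto
  ultimately have "(4 + 6 * \<eta>^4 * L^4) * a\<^sup>2 + (16 * \<eta>\<^sup>2 * L\<^sup>2 + 6 * \<eta>^4 * L^4) * b\<^sup>2 \<le> (3 * ?m)\<^sup>2"
    by (simp add: power_mult_distrib)
  then show ?thesis
    unfolding ogda_D0_def using assms by (intro real_le_lsqrt) auto
qed

lemma tan_residual_scaled_le:
  fixes Z :: "'a::euclidean_space set"
  assumes "c \<in> normal_cone Z x" "\<eta> > 0" "norm (\<eta> *\<^sub>R F x + c) \<le> r"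
  shows "tan_residual Z F x \<le> r / \<eta>"
proof -
  have "(1 / \<eta>) *\<^sub>R c \<in> normal_cone Z x"
    using assms by (intro normal_cone_scaleR) auto
  then have "tan_residual Z F x \<le> norm (F x + (1 / \<eta>) *\<^sub>R c)"
    by (rule tan_residual_le)
  also have "F x + (1 / \<eta>) *\<^sub>R c = (1 / \<eta>) *\<^sub>R (\<eta> *\<^sub>R F x + c)"
    using assms(2) by (simp add: scaleR_add_right)
  also have "norm \<dots> \<le> r / \<eta>"
    using assms(2,3) by (simp add: divide_right_mono)
  finally show ?thesis .
qed

theorem theorem6:
  fixes Z :: "(real ^ 'n) set"
    and F :: "real ^ 'n \<Rightarrow> real ^ 'n"
    and zs :: "real ^ 'n"
    and z w :: "nat \<Rightarrow> real ^ 'n"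
    and L \<eta> D D0 :: real
    and T :: nat
  assumes "closed Z" and "convex Z"
    and "monotone_operator_on Z F"
    and "L > 0" and "L-lipschitz_on Z F"
    and "vi_solution Z F zs"
    and "z 0 \<in> Z" and "w 0 \<in> Z"
    and "0 < \<eta>" and "\<eta> < 1 / (2 * L)"
    and "ogda_iterates Z F \<eta> z w"
    and "D0 = ogda_D0 \<eta> L (norm (z 0 - zs)) (norm (w 0 - z 0))"
    and "T \<ge> 1" and "D > 0"
  shows
    "(\<exists>C>0. \<forall>L' \<eta>' a b. L' > 0 \<longrightarrow> 0 < \<eta>' \<longrightarrow> \<eta>' < 1 / (2 * L') \<longrightarrow> a \<ge> 0 \<longrightarrow> b \<ge> 0 \<longrightarrow>
        ogda_D0 \<eta>' L' a b \<le> C * max a b) \<and>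
     gap Z F D (z T) \<le> D * D0 / (\<eta> * sqrt (real T * (1 - 4 * (\<eta> * L)\<^sup>2))) \<and>
     nat_residual Z F (z T) \<le> tan_residual Z F (z T) \<and>
     tan_residual Z F (z T) \<le> D0 / (\<eta> * sqrt (real T * (1 - 4 * (\<eta> * L)\<^sup>2))) \<and>
     gap Z F D (w (T + 1))
       \<le> sqrt 2 * (2 + \<eta> * L) * D * D0 / (\<eta> * sqrt (real T * (1 - 4 * (\<eta> * L)\<^sup>2))) \<and>
     nat_residual Z F (w (T + 1)) \<le> tan_residual Z F (w (T + 1)) \<and>
     tan_residual Z F (w (T + 1))
       \<le> sqrt 2 * (2 + \<eta> * L) * D0 / (\<eta> * sqrt (real T * (1 - 4 * (\<eta> * L)\<^sup>2)))"
proof -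
  let ?l = "\<eta> * L" and ?G = "\<lambda>x. \<eta> *\<^sub>R F x"
  let ?S = "sqrt (real T * (1 - 4 * (\<eta> * L)\<^sup>2))"
  note Z = assms(1,2) and \<eta> = \<open>0 < \<eta>\<close>
  have l: "0 \<le> ?l" "?l < 1 / 2"
    using assms(4,9,10) by (auto simp: field_simps)
  have it: "ogda_iterates Z ?G 1 z w"
    using assms(11) by (simp add: ogda_iterates_def)
  have mono: "monotone_operator_on Z ?G"
    using assms(3) \<eta> by (simp add: monotone_operator_on_def flip: scaleR_diff_right)
  have lip: "?l-lipschitz_on Z ?G"
    using lipschitz_on_cmult[OF assms(5), of \<eta>] \<eta> by simp
  have vi: "vi_solution Z ?G zs"
    using assms(6) \<eta> by (simp add: vi_solution_def mult_nonneg_nonpos)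
  define c where "c = ogda_normal ?G z w"
  define d where "d k = z k - ?G (w k) - w (Suc k)" for k
  have step: "ogda_step Z ?G ?l (z k) (w k) (z (Suc k)) (w (Suc k)) (c k) (c (Suc k)) (d k)" for k
    unfolding c_def d_def using l by (intro ogda_iterates_step[OF it Z assms(7,8) mono lip]) simp
  have mem: "z k \<in> Z" "w k \<in> Z" for k
    using ogda_iterates_mem[OF it assms(1,7,8)] by auto
  define P where "P = sqrt (ogda_potential ?G (z T) (w T) (c T))"
  have "?l\<^sup>2 < (1 / 2)\<^sup>2"
    using l by (intro power_strict_mono) auto
  then have S: "?S > 0"
    using assms(13) by (simp add: power2_eq_square)
  have "real T * (1 - 4 * ?l\<^sup>2) * ogda_potential ?G (z T) (w T) (c T)
    \<le> (4 + 6 * ?l^4) * (norm (z 0 - zs))\<^sup>2 + (16 * ?l\<^sup>2 + 6 * ?l^4) * (norm (w 0 - z 0))\<^sup>2"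
    by (rule ogda_potential_rate[where z = z and w = w and c = c and d = d, OF step l(2) vi])
  then have "?S * P \<le> D0"
    unfolding P_def assms(12) ogda_D0_def real_sqrt_mult[symmetric]
    by (intro real_sqrt_le_mono) (simp add: power_mult_distrib mult.assoc)
  then have P: "P \<le> D0 / ?S"
    using S by (simp add: field_simps)
  have tz: "tan_residual Z F (z T) \<le> D0 / (\<eta> * ?S)"
  proof -
    have "norm (?G (z T) + c T) \<le> P"
      by (simp add: P_def ogda_potential_def real_le_rsqrt)
    then have "norm (?G (z T) + c T) \<le> D0 / ?S"
      using P by simp
    from tan_residual_scaled_le[where F=F, OF ogda_step.normal(1)[OF step] \<eta> this]
    show ?thesis by (simp add: mult.commute)
  qed
  have tw: "tan_residual Z F (w (T + 1)) \<le> sqrt 2 * (2 + ?l) * D0 / (\<eta> * ?S)"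
  proof -
    have "norm (?G (w (Suc T)) + d T) \<le> sqrt 2 * (2 + ?l) * P"
      unfolding P_def by (rule ogda_step.ogda_lookahead_residual[OF step])
    also have "\<dots> \<le> sqrt 2 * (2 + ?l) * (D0 / ?S)"
      using P l by (intro mult_left_mono) auto
    finally have "norm (?G (w (Suc T)) + d T) \<le> sqrt 2 * (2 + ?l) * (D0 / ?S)" .
    from tan_residual_scaled_le[where F=F, OF ogda_step.normal(3)[OF step] \<eta> this]
    show ?thesis by (simp add: mult.commute)
  qed
  have gz: "gap Z F D (z T) \<le> D * D0 / (\<eta> * ?S)"
    using gap_le_tan_residual[OF assms(1) mem(1)[of T], of D F] mult_left_mono[OF tz, of D] assms(14)
    by simp
  have gw: "gap Z F D (w (T + 1)) \<le> sqrt 2 * (2 + ?l) * D * D0 / (\<eta> * ?S)"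
    using gap_le_tan_residual[OF assms(1) mem(2)[of "T + 1"], of D F]
      mult_left_mono[OF tw, of D] assms(14)
    by (simp add: mult_ac)
  have "\<exists>C>0. \<forall>L' \<eta>' a b. L' > 0 \<longrightarrow> 0 < \<eta>' \<longrightarrow> \<eta>' < 1 / (2 * L') \<longrightarrow> a \<ge> 0 \<longrightarrow> b \<ge> 0 \<longrightarrow>
        ogda_D0 \<eta>' L' a b \<le> C * max a b"
    using ogda_D0_le_max by (intro exI[of _ 3]) auto
  then show ?thesis
    using gz gw tz tw nat_residual_le_tan_residual[OF Z mem(1)]
      nat_residual_le_tan_residual[OF Z mem(2)]
    by blast
qed

end
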